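(* Let $\Sigma$ be a really full rank seed and let $s\in\Gamma_\Sigma$ be a mutable vertex. Then the deleted seed $\Sigma^{/s}$ is really full rank. If moreover $\Sigma$ is sink-recurrent at $s$, then $\Sigma^{/s}$ is really full rank and sink-recurrent.
   Context: Seeds. A seed $\Sigma$ consists of a vertex set $V=[n+m]$ partitioned into $n$ mutable vertices $V\setminus F=[n]$ and $m$ frozen vertices $F$, positive integers $d_i$, and an $(n+m)\times n$ integer matrix $\tilde E$ (the extended exchange matrix; rows indexed by $V$, columns by $V\setminus F$) with $d_j\tilde E_{ij}=-d_i\tilde E_{ji}$ for mutable $i,j$. With $[a]_+=\max(a,0)$, mutation at a mutable vertex $k$ replaces $\tilde E$ by $\tilde E'$ with $\tilde E'_{ij}=-\tilde E_{ij}$ if $k\in\{i,j\}$ and $\tilde E'_{ij}=\tilde E_{ij}+[\tilde E_{ik}]_+[\tilde E_{kj}]_+-[-\tilde E_{ik}]_+[-\tilde E_{kj}]_+$ otherwise. $\Sigma$ is really full rank (RFR) if the rows of $\tilde E$ span $\mathbb{Z}^n$. $\Gamma_\Sigma$ is the directed graph on $V\setminus F$ with an arrow $i\to j$ whenever $\tilde E_{ij}>0$. A vertex $s\in\Gamma_\Sigma$ is a sink if $\tilde E_{vs}\ge0$ for all $v\in V\setminus F$; $N_{in}(s)$ is the set of mutable $v$ with an arrow $v\to s$, and $N(s)$ is the set of all neighbors of $s$ in $\Gamma_\Sigma$. For $I\subset V\setminus F$, $\Sigma^{\backslash I}$ is the seed obtained by freezing all vertices of $I$ (deleting the columns in $I$,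 keeping the rows). Sink-recurrence. The class of sink-recurrent seeds is the smallest class such that: (a) every seed with $\Gamma_\Sigma$ discrete is sink-recurrent; (b) every seed mutation equivalent to a sink-recurrent seed is sink-recurrent; (c) if $s$ is a sink of $\Gamma_\Sigma$ and both $\Sigma^{\backslash s}$ and $\Sigma^{\backslash N_{in}(s)\cup\{s\}}$ are sink-recurrent, then $\Sigma$ is sink-recurrent. In the situation of (c), $\Sigma$ is said to be sink-recurrent at $s$. Deletion. Let $\Sigma$ be an RFR seed and $s\in\Gamma_\Sigma$. Let $\tilde E$ now denote the exchange matrix of $\Sigma^{\backslash N(s)}$ (size $(n+m)\times(n-|N(s)|)$). Its row indexed by $s$ is zero; delete this row to get $\tilde E^{red}$. Let $\chi_s=\tilde E^{red}(e_s)\in\mathbb{Z}^{n+m-1}$ be the column of $s$; it is supported on frozen coordinates of $\Sigma^{\backslash N(s)}$. Delete the column of $s$ from $\tilde E^{red}$ and compose with the quotient of the target $\mathbb{Z}^{n+m-1}\to\mathbb{Z}^{n+m-1}/\mathbb{Z}\chi_s\cong\mathbb{Z}^{n+m-2}$ (the quotient affects only the frozen coordinates; choose a basis of the resulting frozen quotient lattice) to get an $(n+m-2)\times(n-|N(s)|-1)$ matrix $\tilde E^{/s}$. Then $\Sigma^{/s}=(\tilde E^{/s},\{d_i\}_{i\ne s})$; its mutable part is that of $\Sigma^{\backslash N(s)\cup\{s\}}$. If $s$ is a sink then $N(s)=N_{in}(s)$. *)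

theory Defs
  imports Main
begin

section \<open>Seeds\<close>

text \<open>
  Vertices are labelled by an arbitrary type, so that freezing does not force a relabelling.
  The extended exchange matrix is the function \<open>exch\<close>; its rows are indexed by \<open>verts\<close>
  and its columns by \<open>mut\<close>. Values outside these index sets carry no information and are pinned
  to \<open>0\<close>, so that two seeds are equal iff their index sets, multipliers and matrices agree.
  The multipliers enter only through the skew-symmetrizability condition on mutable vertices and
  are recorded only there.
\<close>

record 'v seed =
  verts :: "'v set"
  mut :: "'v set"
  skew :: "'v \<Rightarrow> int"
  exch :: "'v \<Rightarrow> 'v \<Rightarrow> int"

definition is_seed :: "'v seed \<Rightarrow> bool" where
  "is_seed S \<longleftrightarrow>
     finite (verts S) \<and> mut S \<subseteq> verts S \<and>
     (\<forall>i\<in>mut S. skew S i > 0) \<and>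
     (\<forall>i\<in>mut S. \<forall>j\<in>mut S. skew S j * exch S i j = - skew S i * exch S j i) \<and>
     (\<forall>i. i \<notin> mut S \<longrightarrow> skew S i = 0) \<and>
     (\<forall>i j. i \<notin> verts S \<or> j \<notin> mut S \<longrightarrow> exch S i j = 0)"

definition frozen :: "'v seed \<Rightarrow> 'v set" where
  "frozen S = verts S - mut S"

definition mutate :: "'v \<Rightarrow> 'v seed \<Rightarrow> 'v seed" where
  "mutate k S = S\<lparr>exch := (\<lambda>i j.
     if k = i \<or> k = j then - exch S i j
     else exch S i j + max (exch S i k) 0 * max (exch S k j) 0
                     - max (- exch S i k) 0 * max (- exch S k j) 0)\<rparr>"

text \<open>Symmetric, because mutation at a fixed vertex is an involution (\<open>mutate_mutate\<close> below).\<close>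

definition mutation_equivalent :: "'v seed \<Rightarrow> 'v seed \<Rightarrow> bool" where
  "mutation_equivalent = (\<lambda>S T. \<exists>k\<in>mut S. T = mutate k S)\<^sup>*\<^sup>*"

definition freeze :: "'v set \<Rightarrow> 'v seed \<Rightarrow> 'v seed" where
  "freeze I S = \<lparr>verts = verts S, mut = mut S - I,
     skew = (\<lambda>i. if i \<in> I then 0 else skew S i),
     exch = (\<lambda>i j. if j \<in> I then 0 else exch S i j)\<rparr>"

definition really_full_rank :: "'v seed \<Rightarrow> bool" where
  "really_full_rank S \<longleftrightarrow> is_seed S \<and>
     (\<forall>x :: 'v \<Rightarrow> int. \<exists>c :: 'v \<Rightarrow> int. \<forall>j\<in>mut S. (\<Sum>v\<in>verts S. c v * exch S v j) = x j)"

section \<open>The mutable graph and sink-recurrence\<close>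

definition arrow :: "'v seed \<Rightarrow> 'v \<Rightarrow> 'v \<Rightarrow> bool" where
  "arrow S i j \<longleftrightarrow> i \<in> mut S \<and> j \<in> mut S \<and> exch S i j > 0"

definition discrete_graph :: "'v seed \<Rightarrow> bool" where
  "discrete_graph S \<longleftrightarrow> (\<forall>i j. \<not> arrow S i j)"

definition is_sink :: "'v seed \<Rightarrow> 'v \<Rightarrow> bool" where
  "is_sink S s \<longleftrightarrow> s \<in> mut S \<and> (\<forall>v\<in>mut S. exch S v s \<ge> 0)"

definition in_nbrs :: "'v seed \<Rightarrow> 'v \<Rightarrow> 'v set" where
  "in_nbrs S s = {v. arrow S v s}"

definition nbrs :: "'v seed \<Rightarrow> 'v \<Rightarrow> 'v set" where
  "nbrs S s = {v. arrow S v s \<or> arrow S s v}"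

inductive sink_recurrent :: "'v seed \<Rightarrow> bool" where
  discrete: "is_seed S \<Longrightarrow> discrete_graph S \<Longrightarrow> sink_recurrent S"
| mutation: "sink_recurrent S \<Longrightarrow> mutation_equivalent S T \<Longrightarrow> sink_recurrent T"
| sink: "is_seed S \<Longrightarrow> is_sink S s \<Longrightarrow> sink_recurrent (freeze {s} S) \<Longrightarrow>
           sink_recurrent (freeze (in_nbrs S s \<union> {s}) S) \<Longrightarrow> sink_recurrent S"

definition sink_recurrent_at :: "'v seed \<Rightarrow> 'v \<Rightarrow> bool" where
  "sink_recurrent_at S s \<longleftrightarrow> is_seed S \<and> is_sink S s \<and>
     sink_recurrent (freeze {s} S) \<and> sink_recurrent (freeze (in_nbrs S s \<union> {s}) S)"

section \<open>Deletion\<close>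

text \<open>
  The integer vector \<open>x\<close> on \<open>F\<close> has coordinates \<open>c\<close> in the family \<open>b\<close>, indexed by \<open>B\<close>,
  modulo \<open>\<int>\<chi>\<close>.
\<close>

definition has_coords ::
  "'v set \<Rightarrow> ('v \<Rightarrow> int) \<Rightarrow> 'v set \<Rightarrow> ('v \<Rightarrow> 'v \<Rightarrow> int) \<Rightarrow> ('v \<Rightarrow> int) \<Rightarrow> ('v \<Rightarrow> int) \<Rightarrow> bool" where
  "has_coords F \<chi> B b x c \<longleftrightarrow> (\<forall>f. f \<notin> B \<longrightarrow> c f = 0) \<and>
     (\<exists>t::int. \<forall>v\<in>F. x v = (\<Sum>f\<in>B. c f * b f v) + t * \<chi> v)"

text \<open>The classes of the \<open>b f\<close>, for \<open>f \<in> B\<close>, form a \<open>\<int>\<close>-basis of \<open>\<int>\<^sup>F / \<int>\<chi>\<close>.\<close>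

definition quotient_basis ::
  "'v set \<Rightarrow> ('v \<Rightarrow> int) \<Rightarrow> 'v set \<Rightarrow> ('v \<Rightarrow> 'v \<Rightarrow> int) \<Rightarrow> bool" where
  "quotient_basis F \<chi> B b \<longleftrightarrow> finite B \<and> (\<forall>x. \<exists>!c. has_coords F \<chi> B b x c)"

definition quotient_coords ::
  "'v set \<Rightarrow> ('v \<Rightarrow> int) \<Rightarrow> 'v set \<Rightarrow> ('v \<Rightarrow> 'v \<Rightarrow> int) \<Rightarrow> ('v \<Rightarrow> int) \<Rightarrow> 'v \<Rightarrow> int" where
  "quotient_coords F \<chi> B b x = (THE c. has_coords F \<chi> B b x c)"

text \<open>
  The column of \<open>s\<close> after freezing the neighbours of \<open>s\<close>. It vanishes at all vertices that are
  then still mutable, including \<open>s\<close>, so the quotient only concerns the frozen coordinates.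
\<close>

definition del_char :: "'v seed \<Rightarrow> 'v \<Rightarrow> 'v \<Rightarrow> int" where
  "del_char S s v = exch (freeze (nbrs S s) S) v s"

text \<open>
  An admissible choice of basis for the deletion: \<open>B\<close> labels the new frozen vertices. It exists
  for every really full rank seed, see \<open>deletion_basis_exists\<close> below.
\<close>

definition deletion_basis :: "'v seed \<Rightarrow> 'v \<Rightarrow> 'v set \<Rightarrow> ('v \<Rightarrow> 'v \<Rightarrow> int) \<Rightarrow> bool" where
  "deletion_basis S s B b \<longleftrightarrow>
     B \<inter> (mut S - (nbrs S s \<union> {s})) = {} \<and>
     quotient_basis (frozen (freeze (nbrs S s) S)) (del_char S s) B b"

definition deletion :: "'v seed \<Rightarrow> 'v \<Rightarrow> 'v set \<Rightarrow> ('v \<Rightarrow> 'v \<Rightarrow> int) \<Rightarrow> 'v seed" where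
  "deletion S s B b =
     (let R = freeze (nbrs S s) S; M = mut R - {s} in
      \<lparr>verts = M \<union> B, mut = M,
       skew = (\<lambda>i. if i \<in> M then skew R i else 0),
       exch = (\<lambda>i j.
         if j \<notin> M then 0
         else if i \<in> M then exch R i j
         else if i \<in> B then quotient_coords (frozen R) (del_char S s) B b (\<lambda>v. exch R v j) i
         else 0)\<rparr>)"

section \<open>Well-definedness\<close>

lemma mutate_mutate: "mutate k (mutate k S) = S"
  by (cases S) (simp add: mutate_def fun_eq_iff)

lemma exch_self:
  assumes "is_seed S"
  shows "exch S s s = 0"
proof (cases "s \<in> mut S")
  case True
  then have "skew S s > 0" "skew S s * exch S s s = - skew S s * exch S s s"
    using assms unfolding is_seed_def by blast+
  then show ?thesis by simp
next
  case False
  then show ?thesis using assms unfolding is_seed_def by blast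
qed

lemma del_char_mut:
  assumes "is_seed S" "s \<in> mut S" "v \<in> mut S - nbrs S s"
  shows "del_char S s v = 0"
proof (rule ccontr)
  assume "del_char S s v \<noteq> 0"
  then have nz: "exch S v s \<noteq> 0" by (auto simp: del_char_def freeze_def split: if_splits)
  have "\<not> exch S v s > 0" "\<not> exch S s v > 0"
    using assms by (auto simp: nbrs_def arrow_def)
  moreover have "skew S s > 0" "skew S v > 0" "skew S s * exch S v s = - skew S v * exch S s v"
    using assms unfolding is_seed_def by blast+
  ultimately show False using nz
    by (smt (verit) mult_pos_neg mult_minus_left mult_nonneg_nonpos)
qed

lemma quotient_basis_exists:
  fixes \<chi> c :: "'v \<Rightarrow> int"
  assumes "finite F" "(\<Sum>v\<in>F. c v * \<chi> v) = 1"
  shows "\<exists>B b. B \<subseteq> F \<and> quotient_basis F \<chi> B b"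
  using assms(2)
proof (induction "nat (\<Sum>v\<in>F. \<bar>\<chi> v\<bar>)" arbitrary: \<chi> c rule: less_induct)
  case less
  show ?case
  proof (cases "\<exists>p\<in>F. \<exists>q\<in>F. p \<noteq> q \<and> \<chi> q \<noteq> 0 \<and> \<bar>\<chi> q\<bar> \<le> \<bar>\<chi> p\<bar>")
    case True
    then obtain p q where pq: "p \<in> F" "q \<in> F" "p \<noteq> q" "\<chi> q \<noteq> 0" "\<bar>\<chi> q\<bar> \<le> \<bar>\<chi> p\<bar>"
      by blast
    define \<sigma> where "\<sigma> = sgn (\<chi> p) * sgn (\<chi> q)"
    define \<chi>' where "\<chi>' = \<chi>(p := \<chi> p - \<sigma> * \<chi> q)"
    define c' where "c' = c(q := c q + \<sigma> * c p)"
    have split2: "(\<Sum>v\<in>F. g v) = g p + g q + (\<Sum>v\<in>F - {p, q}. g v)" for g :: "'v \<Rightarrow> int"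
    proof -
      have "F = insert p (insert q (F - {p, q}))" using pq by blast
      then have "(\<Sum>v\<in>F. g v) = (\<Sum>v\<in>insert p (insert q (F - {p, q})). g v)"
        by (rule arg_cong)
      also have "\<dots> = g p + g q + (\<Sum>v\<in>F - {p, q}. g v)" using pq \<open>finite F\<close> by simp
      finally show ?thesis .
    qed
    have "(\<Sum>v\<in>F - {p, q}. \<bar>\<chi>' v\<bar>) = (\<Sum>v\<in>F - {p, q}. \<bar>\<chi> v\<bar>)"
      by (rule sum.cong) (auto simp: \<chi>'_def)
    moreover have "\<bar>\<chi>' p\<bar> < \<bar>\<chi> p\<bar>" "\<chi>' q = \<chi> q"
      using pq by (auto simp: \<chi>'_def \<sigma>_def sgn_if)
    ultimately have "(\<Sum>v\<in>F. \<bar>\<chi>' v\<bar>) < (\<Sum>v\<in>F. \<bar>\<chi> v\<bar>)"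
      unfolding split2[of "\<lambda>v. \<bar>\<chi>' v\<bar>"] split2[of "\<lambda>v. \<bar>\<chi> v\<bar>"] by simp
    moreover have "(\<Sum>v\<in>F. \<bar>\<chi>' v\<bar>) \<ge> 0" by (simp add: sum_nonneg)
    ultimately have "nat (\<Sum>v\<in>F. \<bar>\<chi>' v\<bar>) < nat (\<Sum>v\<in>F. \<bar>\<chi> v\<bar>)" by linarith
    moreover have "(\<Sum>v\<in>F. c' v * \<chi>' v) = 1"
    proof -
      have "(\<Sum>v\<in>F - {p, q}. c' v * \<chi>' v) = (\<Sum>v\<in>F - {p, q}. c v * \<chi> v)"
        by (rule sum.cong) (auto simp: \<chi>'_def c'_def)
      moreover have "c' p * \<chi>' p + c' q * \<chi>' q = c p * \<chi> p + c q * \<chi> q"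
        using pq by (simp add: \<chi>'_def c'_def algebra_simps)
      ultimately show ?thesis
        using less.prems unfolding split2[of "\<lambda>v. c' v * \<chi>' v"] split2[of "\<lambda>v. c v * \<chi> v"] by simp
    qed
    ultimately obtain B b' where B: "B \<subseteq> F" "quotient_basis F \<chi>' B b'"
      using less.hyps[of \<chi>' c'] by blast
    define b where "b = (\<lambda>f. (b' f)(p := b' f p + \<sigma> * b' f q))"
    have "has_coords F \<chi> B b x d = has_coords F \<chi>' B b' (x(p := x p - \<sigma> * x q)) d" for x d
    proof -
      have bp: "(\<Sum>f\<in>B. d f * b f p) = (\<Sum>f\<in>B. d f * b' f p) + \<sigma> * (\<Sum>f\<in>B. d f * b' f q)"
        by (simp add: b_def algebra_simps sum.distrib sum_distrib_left)
      have bv: "(\<Sum>f\<in>B. d f * b f v) = (\<Sum>f\<in>B. d f * b' f v)" if "v \<noteq> p" for v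
        using that by (simp add: b_def)
      have "(\<forall>v\<in>F. x v = (\<Sum>f\<in>B. d f * b f v) + t * \<chi> v) \<longleftrightarrow>
            (\<forall>v\<in>F. (x(p := x p - \<sigma> * x q)) v = (\<Sum>f\<in>B. d f * b' f v) + t * \<chi>' v)"
        (is "?L \<longleftrightarrow> ?R") for t
      proof
        assume L: ?L
        then have xp: "x p = (\<Sum>f\<in>B. d f * b f p) + t * \<chi> p"
          and xq: "x q = (\<Sum>f\<in>B. d f * b f q) + t * \<chi> q" using pq by blast+
        have "x p - \<sigma> * x q = (\<Sum>f\<in>B. d f * b' f p) + t * \<chi>' p"
          unfolding xp xq bp using bv[of q] pq by (simp add: \<chi>'_def algebra_simps)
        then show ?R using L bv by (auto simp: \<chi>'_def)
      next
        assume R: ?R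
        then have xp: "x p - \<sigma> * x q = (\<Sum>f\<in>B. d f * b' f p) + t * \<chi>' p"
          and xq: "x q = (\<Sum>f\<in>B. d f * b' f q) + t * \<chi> q"
          using pq by (auto simp: \<chi>'_def)
        have "x p = (\<Sum>f\<in>B. d f * b f p) + t * \<chi> p"
          using xp unfolding bp xq by (simp add: \<chi>'_def algebra_simps)
        moreover have "x v = (\<Sum>f\<in>B. d f * b f v) + t * \<chi> v" if "v \<in> F" "v \<noteq> p" for v
          using bspec[OF R that(1)] that bv[of v] by (simp add: \<chi>'_def)
        ultimately show ?L by blast
      qed
      then show ?thesis by (simp add: has_coords_def)
    qed
    then have "quotient_basis F \<chi> B b"
      using B by (simp add: quotient_basis_def)
    with B show ?thesis by blast
  next
    case False
    have "\<exists>p\<in>F. c p * \<chi> p \<noteq> 0"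
    proof (rule ccontr)
      assume "\<not> ?thesis"
      then have "(\<Sum>v\<in>F. c v * \<chi> v) = 0" by (intro sum.neutral) auto
      with less.prems show False by simp
    qed
    then obtain p where p: "p \<in> F" "\<chi> p \<noteq> 0" by auto
    have z: "\<chi> v = 0" if "v \<in> F" "v \<noteq> p" for v
    proof (rule ccontr)
      assume "\<chi> v \<noteq> 0"
      then show False using False p that by (metis linorder_linear)
    qed
    have "(\<Sum>v\<in>F. c v * \<chi> v) = c p * \<chi> p"
      using p z \<open>finite F\<close> by (simp add: sum.remove[of F p])
    then have unit: "c p * \<chi> p = 1" using less.prems by simp
    define b where "b = (\<lambda>f v :: 'v. if f = v then 1 else 0 :: int)"
    have sb: "(\<Sum>f\<in>F - {p}. d f * b f v) = (if v \<in> F - {p} then d v else 0)" for d v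
      using \<open>finite F\<close> by (simp add: b_def if_distrib sum.delta cong: if_cong)
    have "has_coords F \<chi> (F - {p}) b x d \<longleftrightarrow> d = (\<lambda>v. if v \<in> F - {p} then x v else 0)" for x d
    proof
      assume "has_coords F \<chi> (F - {p}) b x d"
      then show "d = (\<lambda>v. if v \<in> F - {p} then x v else 0)"
        unfolding has_coords_def sb using z by (auto simp: fun_eq_iff)
    next
      assume d: "d = (\<lambda>v. if v \<in> F - {p} then x v else 0)"
      have "x v = (if v \<in> F - {p} then d v else 0) + (x p * c p) * \<chi> v" if "v \<in> F" for v
        using that z[OF that] unit by (cases "v = p") (simp_all add: d mult.assoc)
      moreover have "d f = 0" if "f \<notin> F - {p}" for f using that unfolding d by auto
      ultimately show "has_coords F \<chi> (F - {p}) b x d"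
        unfolding has_coords_def sb by blast
    qed
    then have "quotient_basis F \<chi> (F - {p}) b"
      using \<open>finite F\<close> by (simp add: quotient_basis_def)
    then show ?thesis by blast
  qed
qed

lemma deletion_basis_exists:
  assumes "really_full_rank S" "s \<in> mut S"
  shows "\<exists>B b. deletion_basis S s B b"
proof -
  let ?F = "frozen (freeze (nbrs S s) S)"
  have seed: "is_seed S" and sub: "mut S \<subseteq> verts S" "finite (verts S)"
    using assms(1) unfolding really_full_rank_def is_seed_def by blast+
  have "\<exists>c. \<forall>j\<in>mut S. (\<Sum>v\<in>verts S. c v * exch S v j) = (\<lambda>_. 1) j"
    using assms(1) unfolding really_full_rank_def by (elim conjE allE)
  then obtain c where "(\<Sum>v\<in>verts S. c v * exch S v s) = 1" using assms(2) by blast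
  moreover have "del_char S s v = exch S v s" for v
    using exch_self[OF seed] by (simp add: del_char_def freeze_def nbrs_def arrow_def)
  ultimately have "(\<Sum>v\<in>verts S. c v * del_char S s v) = 1" by simp
  moreover have "(\<Sum>v\<in>?F. c v * del_char S s v) = (\<Sum>v\<in>verts S. c v * del_char S s v)"
    by (rule sum.mono_neutral_left)
      (use sub del_char_mut[OF seed assms(2)] in \<open>auto simp: frozen_def freeze_def\<close>)
  moreover have "finite ?F" using sub by (simp add: frozen_def freeze_def)
  ultimately obtain B b where B: "B \<subseteq> ?F" "quotient_basis ?F (del_char S s) B b"
    using quotient_basis_exists[of ?F c "del_char S s"] by metis
  have "?F \<inter> (mut S - (nbrs S s \<union> {s})) = {}"
    by (simp add: frozen_def freeze_def) blast
  with B(1) have "B \<inter> (mut S - (nbrs S s \<union> {s})) = {}" by blast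
  with B(2) show ?thesis unfolding deletion_basis_def by blast
qed

end

theory Submission
  imports Defs
begin

text \<open>
  Full rank: a functional on \<open>\<int>\<^sup>V\<close> that takes the value \<open>0\<close> on the column of \<open>s\<close> and prescribed values
  on the columns that stay mutable descends to the quotient by \<open>\<int>\<chi>\<close>, and its values on the chosen
  basis are the coefficients of the new frozen rows.
  Sink-recurrence: it depends only on the mutable part of a seed, and the deletion at a sink has
  the same mutable part as the seed in which the sink and its in-neighbours are frozen.
\<close>

text \<open>Arrows, and the effect of a mutation on entries between mutable vertices, are computed
  from these entries alone. So the relation leaves frozen rows and multipliers free to differ and
  still survives mutation and freezing.\<close>

definition same_mutable_part :: "'v seed \<Rightarrow> 'v seed \<Rightarrow> bool" where
  "same_mutable_part S T \<longleftrightarrow>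
     mut S = mut T \<and> (\<forall>i\<in>mut S. \<forall>j\<in>mut S. exch S i j = exch T i j)"

section \<open>Mutation and freezing preserve seeds\<close>

lemma mutate_fields [simp]:
  "mut (mutate k S) = mut S" "verts (mutate k S) = verts S" "skew (mutate k S) = skew S"
  by (simp_all add: mutate_def)

text \<open>The multipliers stay the same. Transposing turns the positive correction term at
  \<open>(i, j)\<close> into the negative one at \<open>(j, i)\<close>, with exactly the change of
  multiplier that skew-symmetrizability asks for; this is \<open>prods\<close>.\<close>

lemma is_seed_mutate:
  assumes S: "is_seed S" and k: "k \<in> mut S"
  shows "is_seed (mutate k S)"
proof -
  let ?E = "exch S" and ?d = "skew S"
  have sym: "?d j * ?E i j = - ?d i * ?E j i" if "i \<in> mut S" "j \<in> mut S" for i j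
    using S that unfolding is_seed_def by blast
  have pos: "?d i > 0" if "i \<in> mut S" for i
    using S that unfolding is_seed_def by blast
  have scale: "c * max x 0 = max (c * x) 0" if "c > 0" for c x :: int
    using that by (auto simp: max_def zero_less_mult_iff mult_le_0_iff)
  have prods: "?d j * (max (?E i k) 0 * max (?E k j) 0) = ?d i * (max (- ?E j k) 0 * max (- ?E k i) 0)"
    if i: "i \<in> mut S" and j: "j \<in> mut S" for i j
  proof -
    \<comment> \<open>The multiplier is carried from \<open>j\<close> to \<open>k\<close> along one
      factor and from \<open>k\<close> to \<open>i\<close> along the other.\<close>
    have "?d j * max (?E k j) 0 = ?d k * max (- ?E j k) 0"
      using sym[OF k j] by (simp add: scale pos j k)
    moreover have "?d k * max (?E i k) 0 = ?d i * max (- ?E k i) 0"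
      using sym[OF i k] by (simp add: scale pos i k)
    ultimately show ?thesis by (metis mult.commute mult.left_commute)
  qed
  have "?d j * exch (mutate k S) i j = - ?d i * exch (mutate k S) j i"
    if i: "i \<in> mut S" and j: "j \<in> mut S" for i j
  proof (cases "k = i \<or> k = j")
    case True
    then show ?thesis using sym[OF i j] by (auto simp: mutate_def)
  next
    case False
    then have E: "exch (mutate k S) i j = ?E i j + max (?E i k) 0 * max (?E k j) 0
        - max (- ?E i k) 0 * max (- ?E k j) 0"
      "exch (mutate k S) j i = ?E j i + max (?E j k) 0 * max (?E k i) 0
        - max (- ?E j k) 0 * max (- ?E k i) 0"
      by (simp_all add: mutate_def)
    show ?thesis
      using sym[OF i j] prods[OF i j] prods[OF j i]
      unfolding E right_diff_distrib distrib_left mult_minus_left by linarith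
  qed
  moreover have "exch (mutate k S) i j = 0" if "i \<notin> verts S \<or> j \<notin> mut S" for i j
    using S that unfolding is_seed_def mutate_def by auto
  moreover have "finite (verts S)" "mut S \<subseteq> verts S" "\<forall>i. i \<notin> mut S \<longrightarrow> ?d i = 0"
    using S unfolding is_seed_def by blast+
  ultimately show ?thesis
    using pos unfolding is_seed_def mutate_fields by (intro conjI) blast+
qed

lemma is_seed_freeze:
  assumes S: "is_seed S"
  shows "is_seed (freeze I S)"
  unfolding is_seed_def
proof (intro conjI ballI allI impI)
  have "finite (verts S)" "mut S \<subseteq> verts S"
    using S unfolding is_seed_def by blast+
  then show "finite (verts (freeze I S))" "mut (freeze I S) \<subseteq> verts (freeze I S)"
    by (auto simp: freeze_def)
next
  fix i assume i: "i \<in> mut (freeze I S)"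
  then have "i \<in> mut S" by (simp add: freeze_def)
  then have "skew S i > 0" using S unfolding is_seed_def by blast
  then show "skew (freeze I S) i > 0" using i by (simp add: freeze_def)
  fix j assume j: "j \<in> mut (freeze I S)"
  have "i \<in> mut S" "j \<in> mut S" using i j by (simp_all add: freeze_def)
  then have "skew S j * exch S i j = - skew S i * exch S j i"
    using S unfolding is_seed_def by blast
  then show "skew (freeze I S) j * exch (freeze I S) i j = - skew (freeze I S) i * exch (freeze I S) j i"
    using i j by (simp add: freeze_def)
next
  fix i assume "i \<notin> mut (freeze I S)"
  moreover have "skew S i = 0" if "i \<notin> mut S"
    using S that unfolding is_seed_def by blast
  ultimately show "skew (freeze I S) i = 0" by (auto simp: freeze_def)
next
  fix i j assume "i \<notin> verts (freeze I S) \<or> j \<notin> mut (freeze I S)"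
  moreover have "exch S i j = 0" if "i \<notin> verts S \<or> j \<notin> mut S"
    using S that unfolding is_seed_def by blast
  ultimately show "exch (freeze I S) i j = 0" by (auto simp: freeze_def)
qed

section \<open>Sink-recurrence as an invariant of the mutable part\<close>

lemma same_mutable_part_mutate:
  assumes "same_mutable_part S T" "k \<in> mut S"
  shows "same_mutable_part (mutate k S) (mutate k T)"
  using assms unfolding same_mutable_part_def mutate_def by simp

lemma same_mutable_part_freeze:
  assumes "same_mutable_part S T"
  shows "same_mutable_part (freeze I S) (freeze I T)"
  using assms unfolding same_mutable_part_def freeze_def by simp

text \<open>The mutation sequence is run backwards from \<open>T'\<close>, each mutation being its
  own inverse. The lift starts at the far end because the induction on sink-recurrence supplies a
  seed comparable to the result of the mutations and needs one comparable to their source.\<close>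

lemma mutation_equivalent_lift:
  assumes "mutation_equivalent S T" "is_seed T'" "same_mutable_part T T'"
  obtains S' where "is_seed S'" "same_mutable_part S S'" "mutation_equivalent S' T'"
proof -
  have "\<exists>S'. is_seed S' \<and> same_mutable_part S S' \<and> mutation_equivalent S' T'"
    using assms unfolding mutation_equivalent_def
  proof (induction arbitrary: T' rule: rtranclp_induct)
    case base
    then show ?case by blast
  next
    case (step U T)
    then obtain k where k: "k \<in> mut U" "T = mutate k U" by blast
    then have kT: "k \<in> mut T" "k \<in> mut T'"
      using step.prems by (auto simp: same_mutable_part_def)
    \<comment> \<open>Mutating \<open>T\<close> at \<open>k\<close> once more gives back
      \<open>U\<close>.\<close>
    have "same_mutable_part U (mutate k T')"
      using same_mutable_part_mutate[OF step.prems(2) kT(1)] by (simp add: k mutate_mutate)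
    from step.IH[OF is_seed_mutate[OF step.prems(1) kT(2)] this]
    obtain S' where S': "is_seed S'" "same_mutable_part S S'"
      "(\<lambda>S T. \<exists>k\<in>mut S. T = mutate k S)\<^sup>*\<^sup>* S' (mutate k T')" by blast
    have "\<exists>j\<in>mut (mutate k T'). T' = mutate j (mutate k T')"
      using kT(2) by (intro bexI[of _ k]) (simp_all add: mutate_mutate)
    from rtranclp.rtrancl_into_rtrancl[OF S'(3) this] S'(1,2) show ?case by blast
  qed
  then show thesis using that by blast
qed

text \<open>Discreteness, sinks and in-neighbours are read off the mutable part, and freezing
  respects the relation. In the mutation case the hypothesis is applied to the lifted seed
  \<open>S'\<close>, so \<open>T\<close> has to be arbitrary in the induction.\<close>

lemma sink_recurrent_cong:
  assumes "sink_recurrent S" "is_seed T" "same_mutable_part S T"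
  shows "sink_recurrent T"
  using assms
proof (induction arbitrary: T rule: sink_recurrent.induct)
  case (discrete S)
  then show ?case
    by (intro sink_recurrent.discrete)
      (auto simp: discrete_graph_def arrow_def same_mutable_part_def)
next
  case (mutation S U)
  then obtain S' where "is_seed S'" "same_mutable_part S S'" "mutation_equivalent S' T"
    using mutation_equivalent_lift by blast
  then show ?case
    using mutation.IH sink_recurrent.mutation by blast
next
  case (sink S s)
  have "is_sink T s" "in_nbrs T s = in_nbrs S s"
    using sink.prems sink.hyps
    by (auto simp: is_sink_def in_nbrs_def arrow_def same_mutable_part_def)
  moreover have "sink_recurrent (freeze {s} T)" "sink_recurrent (freeze (in_nbrs S s \<union> {s}) T)"
    using sink.IH sink.prems is_seed_freeze same_mutable_part_freeze by blast+
  ultimately show ?case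
    using sink.prems(1) sink_recurrent.sink[of T s] by simp
qed

section \<open>Local structure at the deleted vertex\<close>

lemma nbrs_sink:
  assumes "is_seed S" "is_sink S s"
  shows "nbrs S s = in_nbrs S s"
proof -
  have "\<not> arrow S s v" for v
  proof
    assume "arrow S s v"
    then have v: "v \<in> mut S" "exch S s v > 0" by (auto simp: arrow_def)
    \<comment> \<open>Entries \<open>exch S v s\<close> and \<open>exch S s v\<close> have opposite
      signs, so a sink has no outgoing arrow.\<close>
    have "skew S v > 0" "skew S s > 0" "skew S s * exch S v s = - skew S v * exch S s v"
      "exch S v s \<ge> 0"
      using assms v(1) unfolding is_seed_def is_sink_def by blast+
    with v(2) show False
      by (smt (verit) mult_minus_left mult_nonneg_nonneg mult_pos_pos)
  qed
  then show ?thesis by (simp add: nbrs_def in_nbrs_def)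
qed

text \<open>With no arrow either way both entries are nonpositive, while skew-symmetrizability gives
  them opposite signs. This is why deletion may drop the row of \<open>s\<close>.\<close>

lemma exch_nonadjacent:
  assumes S: "is_seed S" and "s \<in> mut S" "j \<in> mut S - nbrs S s"
  shows "exch S s j = 0"
proof -
  have "exch S j s \<le> 0" "exch S s j \<le> 0"
    using assms(2,3) by (auto simp: nbrs_def arrow_def not_less)
  moreover have "skew S j > 0" "skew S s > 0" "skew S s * exch S j s = - skew S j * exch S s j"
    using assms unfolding is_seed_def by blast+
  ultimately show ?thesis
    by (smt (verit) mult_minus_left mult_nonneg_nonpos mult_pos_neg)
qed

text \<open>The diagonal entry is zero, so \<open>s\<close> is not its own neighbour and its column
  survives the freezing.\<close>

lemma del_char_eq:
  assumes "is_seed S"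
  shows "del_char S s v = exch S v s"
  using exch_self[OF assms] by (simp add: del_char_def freeze_def nbrs_def arrow_def)

lemma mut_deletion: "mut (deletion S s B b) = mut S - (nbrs S s \<union> {s})"
  by (auto simp: deletion_def Let_def freeze_def)

lemma is_seed_deletion:
  assumes S: "is_seed S" and fin: "finite B"
  shows "is_seed (deletion S s B b)"
proof -
  define D where "D = deletion S s B b"
  define R where "R = freeze (nbrs S s) S"
  define M where "M = mut R - {s}"
  have R: "is_seed R" using is_seed_freeze[OF S] by (simp add: R_def)
  have D: "mut D = M" "verts D = M \<union> B" "skew D i = (if i \<in> M then skew R i else 0)"
    "i \<in> M \<Longrightarrow> j \<in> M \<Longrightarrow> exch D i j = exch R i j"
    "i \<notin> M \<union> B \<or> j \<notin> M \<Longrightarrow> exch D i j = 0" for i j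
    by (auto simp: D_def R_def M_def deletion_def Let_def)
  have sub: "M \<subseteq> mut R" by (auto simp: M_def)
  have "is_seed D"
    unfolding is_seed_def D(1,2)
  proof (intro conjI ballI allI impI)
    have "finite (verts R)" "mut R \<subseteq> verts R" using R unfolding is_seed_def by blast+
    then show "finite (M \<union> B)" using fin sub by (meson finite_Un finite_subset)
    show "M \<subseteq> M \<union> B" by blast
  next
    fix i assume i: "i \<in> M"
    have "skew R i > 0" using R i sub unfolding is_seed_def by blast
    then show "skew D i > 0" using i by (simp add: D(3))
    fix j assume j: "j \<in> M"
    have "skew R j * exch R i j = - skew R i * exch R j i"
      using R i j sub unfolding is_seed_def by blast
    then show "skew D j * exch D i j = - skew D i * exch D j i" using i j by (simp add: D(3,4))
  qed (simp_all only: D(3,5) if_False)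
  then show ?thesis by (simp add: D_def)
qed

section \<open>Functionals on the quotient lattice and full rank\<close>

lemma has_coords_quotient_coords:
  assumes "quotient_basis F \<chi> B b"
  shows "has_coords F \<chi> B b x (quotient_coords F \<chi> B b x)"
  using assms unfolding quotient_basis_def quotient_coords_def by (metis theI')

text \<open>Expand \<open>x\<close> in the \<open>b f\<close> plus a multiple of
  \<open>\<chi>\<close>. The functional \<open>c\<close> kills that multiple, so what remains is its
  values on the basis weighted by the coordinates of \<open>x\<close>.\<close>

lemma sum_quotient_coords:
  assumes "quotient_basis F \<chi> B b" and ker: "(\<Sum>v\<in>F. c v * \<chi> v) = 0"
  shows "(\<Sum>f\<in>B. (\<Sum>v\<in>F. c v * b f v) * quotient_coords F \<chi> B b x f) = (\<Sum>v\<in>F. c v * x v)"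
proof -
  let ?q = "quotient_coords F \<chi> B b x"
  obtain t where t: "\<forall>v\<in>F. x v = (\<Sum>f\<in>B. ?q f * b f v) + t * \<chi> v"
    using has_coords_quotient_coords[OF assms(1), of x] unfolding has_coords_def by blast
  have "(\<Sum>v\<in>F. c v * x v) = (\<Sum>v\<in>F. (\<Sum>f\<in>B. c v * b f v * ?q f) + t * (c v * \<chi> v))"
    using t by (intro sum.cong) (simp_all add: algebra_simps sum_distrib_left)
  also have "\<dots> = (\<Sum>v\<in>F. \<Sum>f\<in>B. c v * b f v * ?q f)"
    by (simp add: sum.distrib ker flip: sum_distrib_left)
  also have "\<dots> = (\<Sum>f\<in>B. (\<Sum>v\<in>F. c v * b f v) * ?q f)"
    by (subst sum.swap) (simp add: sum_distrib_right)
  finally show ?thesis by simp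
qed

lemma really_full_rank_deletion:
  assumes S: "really_full_rank S" and s: "s \<in> mut S" and B: "deletion_basis S s B b"
  shows "really_full_rank (deletion S s B b)"
proof -
  define D where "D = deletion S s B b"
  define M where "M = mut S - (nbrs S s \<union> {s})"
  define F where "F = frozen (freeze (nbrs S s) S)"
  let ?\<chi> = "del_char S s"
  have seed: "is_seed S" using S by (simp add: really_full_rank_def)
  then have fin: "finite (verts S)" and sub: "mut S \<subseteq> verts S" by (auto simp: is_seed_def)
  have basis: "quotient_basis F ?\<chi> B b" and disj: "B \<inter> M = {}"
    using B by (auto simp: deletion_basis_def F_def M_def)
  then have finB: "finite B" by (simp add: quotient_basis_def)
  have "s \<notin> nbrs S s" using exch_self[OF seed] by (simp add: nbrs_def arrow_def)
  then have "verts S = insert s (M \<union> F)" "s \<notin> M \<union> F" "M \<inter> F = {}"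
    using sub s by (auto simp: M_def F_def frozen_def freeze_def)
  moreover from this(1) have "finite M" "finite F" using fin by (metis finite_Un finite_insert)+
  ultimately have split: "(\<Sum>v\<in>verts S. g v) = g s + (\<Sum>v\<in>M. g v) + (\<Sum>v\<in>F. g v)"
    for g :: "'a \<Rightarrow> int"
    by (simp add: sum.union_disjoint)
  have "\<exists>c. \<forall>j\<in>mut D. (\<Sum>v\<in>verts D. c v * exch D v j) = x j" for x
  proof -
    \<comment> \<open>The value at \<open>s\<close> is prescribed to be 0, so that \<open>a\<close>
      annihilates the column of \<open>s\<close>.\<close>
    have "\<exists>a. \<forall>j\<in>mut S. (\<Sum>v\<in>verts S. a v * exch S v j) = (\<lambda>j. if j = s then 0 else x j) j"
      using S unfolding really_full_rank_def by (elim conjE allE)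
    then obtain a where
      a: "\<forall>j\<in>mut S. (\<Sum>v\<in>verts S. a v * exch S v j) = (if j = s then 0 else x j)" by auto
    have "(\<Sum>v\<in>verts S. a v * ?\<chi> v) = 0"
      using a s by (simp add: del_char_eq[OF seed])
    moreover have "(\<Sum>v\<in>M. a v * ?\<chi> v) = 0"
      using del_char_mut[OF seed s] by (simp add: M_def)
    moreover have "?\<chi> s = 0" by (simp add: del_char_eq[OF seed] exch_self[OF seed])
    \<comment> \<open>The column of \<open>s\<close> is supported on \<open>F\<close>, so the
      restriction of \<open>a\<close> to \<open>F\<close> already kills it and descends to the
      quotient.\<close>
    ultimately have ker: "(\<Sum>v\<in>F. a v * ?\<chi> v) = 0" by (simp add: split)
    \<comment> \<open>Old mutable rows keep their coefficients; a new frozen row \<open>i\<close>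
      gets the value of the functional on \<open>b i\<close>. Disjointness of \<open>B\<close> and
      \<open>M\<close> keeps the two cases apart.\<close>
    define c where "c i = (if i \<in> M then a i else \<Sum>v\<in>F. a v * b i v)" for i
    have "(\<Sum>v\<in>verts D. c v * exch D v j) = x j" if "j \<in> mut D" for j
    proof -
      have j: "j \<in> M" "j \<in> mut S - nbrs S s" "j \<noteq> s" "j \<notin> nbrs S s"
        using that by (auto simp: D_def mut_deletion M_def)
      let ?q = "quotient_coords F ?\<chi> B b (\<lambda>v. exch S v j)"
      have MD: "mut (freeze (nbrs S s) S) - {s} = M" by (auto simp: freeze_def M_def)
      have "verts D = M \<union> B" by (simp add: D_def deletion_def Let_def MD)
      moreover have eM: "exch D i j = exch S i j" if "i \<in> M" for i
        using j that by (simp add: D_def deletion_def Let_def MD) (simp add: freeze_def)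
      moreover have eB: "exch D i j = ?q i" if "i \<in> B" for i
        using j that disj
        by (auto simp: D_def deletion_def Let_def MD simp flip: F_def) (simp_all add: freeze_def)
      ultimately have "(\<Sum>v\<in>verts D. c v * exch D v j) =
          (\<Sum>v\<in>M. c v * exch D v j) + (\<Sum>v\<in>B. c v * exch D v j)"
        using \<open>finite M\<close> finB disj by (simp add: sum.union_disjoint Int_commute)
      also have "(\<Sum>v\<in>M. c v * exch D v j) = (\<Sum>v\<in>M. a v * exch S v j)"
        by (rule sum.cong) (simp_all add: c_def eM)
      also have "(\<Sum>v\<in>B. c v * exch D v j) = (\<Sum>f\<in>B. (\<Sum>v\<in>F. a v * b f v) * ?q f)"
        using disj by (intro sum.cong) (auto simp: c_def eB)
      also have "\<dots> = (\<Sum>v\<in>F. a v * exch S v j)"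
        by (rule sum_quotient_coords[OF basis ker])
      \<comment> \<open>Only the row of \<open>s\<close> is missing on the left, and its entry in
        column \<open>j\<close> is zero.\<close>
      also have "(\<Sum>v\<in>M. a v * exch S v j) + (\<Sum>v\<in>F. a v * exch S v j) =
          (\<Sum>v\<in>verts S. a v * exch S v j)"
        by (simp add: split exch_nonadjacent[OF seed s j(2)])
      also have "\<dots> = x j" using a j by simp
      finally show ?thesis .
    qed
    then show ?thesis by blast
  qed
  then show ?thesis
    using is_seed_deletion[OF seed finB] by (simp add: really_full_rank_def D_def)
qed

text \<open>In \<open>deletion\<close> the branch for remaining mutable rows precedes the one for
  \<open>B\<close>, so the choice of basis cannot affect entries between mutable vertices.\<close>

lemma same_mutable_part_deletion:
  "same_mutable_part (freeze (nbrs S s \<union> {s}) S) (deletion S s B b)"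
  unfolding same_mutable_part_def mut_deletion
  by (auto simp: deletion_def Let_def freeze_def)

theorem proposition4p13:
  fixes S :: "'v seed" and s :: 'v and B :: "'v set" and b :: "'v \<Rightarrow> 'v \<Rightarrow> int"
  assumes "really_full_rank S" and "s \<in> mut S" and "deletion_basis S s B b"
  shows "really_full_rank (deletion S s B b) \<and>
         (sink_recurrent_at S s \<longrightarrow>
            really_full_rank (deletion S s B b) \<and> sink_recurrent (deletion S s B b))"
proof -
  have rfr: "really_full_rank (deletion S s B b)"
    by (rule really_full_rank_deletion[OF assms])
  moreover have "sink_recurrent (deletion S s B b)" if "sink_recurrent_at S s"
  proof -
    have "sink_recurrent (freeze (nbrs S s \<union> {s}) S)"
      using that nbrs_sink[of S s] by (simp add: sink_recurrent_at_def)
    moreover have "is_seed (deletion S s B b)"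
      using rfr by (simp add: really_full_rank_def)
    ultimately show ?thesis
      using same_mutable_part_deletion by (rule sink_recurrent_cong)
  qed
  ultimately show ?thesis by blast
qed

end
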